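(* Let $\mathcal{C}\subset[N]$ be an arbitrary coalition, and suppose $b>0$ and $\mu_i>0$ for all $i\in[N]$. Then the $\mathcal{C}$-Nash equilibrium $x^\dagger$ of the charging game exists, is unique, and for every $t\in[T]$ takes the form $$x^{\dagger t}=\frac{d}{T}+\sum_{t'\in[T]}\frac{T\delta^{tt'}-1}{T}\left(b(\mathbf{1}_N\mathbf{1}_N^\top+\mathbf{C})+\mu\right)^{-1}\left(\mu\bar{x}^{t'}-a^{t'}\mathbf{1}_N\right).$$
   Context: For a positive integer $m$, $[m]=\{1,\dots,m\}$; $\mathbf{1}_N\in\mathbb{R}^N$ is the all-ones vector; $\delta^{tt'}$ is the Kronecker delta; $\|\cdot\|$ is the Euclidean norm. Charging game: there are $N$ charging stations and $T$ time steps. Station $i\in[N]$ has a nominal charging profile $\bar{x}_i=(\bar{x}_i^t)_{t\in[T]}\in\mathbb{R}^T$ with total demand $d_i=\sum_{t\in[T]}\bar{x}_i^t$, and sensitivity parameter $\mu_i>0$. Its feasible set is $X_i=\{x_i\in\mathbb{R}^T:\sum_{t\in[T]}x_i^t=d_i\}$ (no sign constraints), and $X=\prod_{i\in[N]}X_i$. For a joint profile $x=(x_i^t)_{i\in[N],t\in[T]}$, write $x^t=(x_i^t)_{i\in[N]}\in\mathbb{R}^N$; similarly $\bar{x}^t=(\bar{x}_i^t)_{i\in[N]}$, and $d=(d_i)_{i\in[N]}\in\mathbb{R}^N$. The price at time $t$ is $p^t(x)=a^t+b\,\mathbf{1}_N^\top x^t$ with $a^t>0$ and $b>0$. The cost of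 station $i$ is $$c_i(x)=\sum_{t\in[T]}p^t(x)x_i^t+\frac{\mu_i}{2}\|x_i-\bar{x}_i\|^2.$$ For a coalition $\mathcal{C}\subset[N]$, a joint profile $x^\dagger\in X$ is a $\mathcal{C}$-Nash equilibrium if (i) $\sum_{i\in\mathcal{C}}c_i(x^\dagger)\le\sum_{i\in\mathcal{C}}c_i(x'_{\mathcal{C}},x^\dagger_{-\mathcal{C}})$ for every $x'_{\mathcal{C}}\in\prod_{j\in\mathcal{C}}X_j$, and (ii) $c_i(x^\dagger)\le c_i(x_i',x^\dagger_{-i})$ for every $i\notin\mathcal{C}$ and every $x_i'\in X_i$. Here $x_{-\mathcal{C}}$ (resp. $x_{-i}$) denotes the profiles of stations not in $\mathcal{C}$ (resp. other than $i$). Matrices: $\mu=\mathrm{diag}(\mu_1,\dots,\mu_N)$, and $\mathbf{C}=\begin{pmatrix}\mathbf{1}_{\mathcal{C}}\mathbf{1}_{\mathcal{C}}^\top&0\\0&I_{[N]\setminus\mathcal{C}}\end{pmatrix}\in\mathbb{R}^{N\times N}$ in block form with respect to $\mathcal{C}$ and $[N]\setminus\mathcal{C}$; i.e. $\mathbf{C}_{ij}=1$ if $i,j\in\mathcal{C}$ or if $i=j\notin\mathcal{C}$, and $\mathbf{C}_{ij}=0$ otherwise. *)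

theory Defs
  imports "HOL-Analysis.Analysis"
begin

text \<open>Stations are indexed by the finite type \<open>'n\<close> and time steps by the finite type \<open>'t\<close>,
  so \<open>N = CARD('n)\<close> and \<open>T = CARD('t)\<close>. A joint profile is \<open>x :: real^'t^'n\<close>:
  its row \<open>x $ i\<close> is the profile \<open>x\<^sub>i\<close> of station \<open>i\<close>, and \<open>column t x\<close> is the vector
  \<open>x\<^sup>t\<close> of all stations' charges at time \<open>t\<close>. The numeral \<open>1 :: real^'n\<close> is the all-ones vector.\<close>

definition demand :: "real^'t^'n \<Rightarrow> real^'n" where
  "demand xbar = (\<chi> i. \<Sum>t\<in>UNIV. xbar $ i $ t)"

definition feasible :: "real^'t^'n \<Rightarrow> 'n \<Rightarrow> (real^'t) set" where
  "feasible xbar i = {y. (\<Sum>t\<in>UNIV. y $ t) = demand xbar $ i}"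

definition joint_feasible :: "real^'t^'n \<Rightarrow> (real^'t^'n) set" where
  "joint_feasible xbar = {x. \<forall>i. x $ i \<in> feasible xbar i}"

definition price :: "real^'t \<Rightarrow> real \<Rightarrow> real^'t^'n \<Rightarrow> 't \<Rightarrow> real" where
  "price a b x t = a $ t + b * (1 \<bullet> column t x)"

definition cost ::
  "real^'t \<Rightarrow> real \<Rightarrow> real^'n \<Rightarrow> real^'t^'n \<Rightarrow> real^'t^'n \<Rightarrow> 'n \<Rightarrow> real" where
  "cost a b \<mu> xbar x i =
     (\<Sum>t\<in>UNIV. price a b x t * x $ i $ t) + \<mu> $ i / 2 * (norm (x $ i - xbar $ i))\<^sup>2"

text \<open>The profile \<open>(x'\<^sub>C, x\<^sub>-\<^sub>C)\<close>; the rows of \<open>x'\<close> outside \<open>C\<close> are irrelevant.\<close>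

definition coalition_deviation :: "'n set \<Rightarrow> real^'t^'n \<Rightarrow> real^'t^'n \<Rightarrow> real^'t^'n" where
  "coalition_deviation C x' x = (\<chi> j. if j \<in> C then x' $ j else x $ j)"

definition single_deviation :: "'n \<Rightarrow> real^'t \<Rightarrow> real^'t^'n \<Rightarrow> real^'t^'n" where
  "single_deviation i y x = (\<chi> j. if j = i then y else x $ j)"

definition coalition_nash ::
  "real^'t \<Rightarrow> real \<Rightarrow> real^'n \<Rightarrow> real^'t^'n \<Rightarrow> 'n set \<Rightarrow> real^'t^'n \<Rightarrow> bool" where
  "coalition_nash a b \<mu> xbar C x \<longleftrightarrow>
     x \<in> joint_feasible xbar \<and>
     (\<forall>x'. (\<forall>j\<in>C. x' $ j \<in> feasible xbar j) \<longrightarrow>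
        (\<Sum>i\<in>C. cost a b \<mu> xbar x i)
          \<le> (\<Sum>i\<in>C. cost a b \<mu> xbar (coalition_deviation C x' x) i)) \<and>
     (\<forall>i. i \<notin> C \<longrightarrow> (\<forall>y\<in>feasible xbar i.
        cost a b \<mu> xbar x i \<le> cost a b \<mu> xbar (single_deviation i y x) i))"

definition outer :: "real^'n \<Rightarrow> real^'n \<Rightarrow> real^'n^'n" where
  "outer u v = (\<chi> i j. u $ i * v $ j)"

definition diag_matrix :: "real^'n \<Rightarrow> real^'n^'n" where
  "diag_matrix v = (\<chi> i j. if i = j then v $ i else 0)"

definition coalition_matrix :: "'n set \<Rightarrow> real^'n^'n" where
  "coalition_matrix C = (\<chi> i j. if (i \<in> C \<and> j \<in> C) \<or> (i = j \<and> i \<notin> C) then 1 else 0)"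

definition game_matrix :: "real \<Rightarrow> real^'n \<Rightarrow> 'n set \<Rightarrow> real^'n^'n" where
  "game_matrix b \<mu> C = b *\<^sub>R (outer 1 1 + coalition_matrix C) + diag_matrix \<mu>"

definition kronecker :: "'t \<Rightarrow> 't \<Rightarrow> real" where
  "kronecker t t' = (if t = t' then 1 else 0)"

end

theory Submission
  imports Defs
begin

text \<open>
  Both kinds of equilibrium condition say the same thing about a group \<open>G\<close> of stations, namely that
  \<open>G\<close> cannot lower its total cost by a joint feasible deviation: \<open>G\<close> is the coalition, or a
  single outsider. The total cost of \<open>G\<close> is a quadratic function of the deviation, with a
  positive semidefinite second-order part (\<open>sum_cost_add\<close>). Feasible deviations are exactly those
  that add up to zero over time for every station, so optimality of \<open>G\<close> means that the first-order
  part vanishes on them, i.e. that the marginal cost of each member of \<open>G\<close> is the same at all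
  times (\<open>group_optimal_iff\<close>).

  Marginal costs of all stations, each with respect to its own group, form the vector
  \<open>M x\<^sup>t - w\<^sup>t\<close> with \<open>M = b (1 1\<^sup>T + C) + \<mu>\<close> the game matrix and
  \<open>w\<^sup>t = \<mu> xbar\<^sup>t - a\<^sup>t 1\<close>. Hence \<open>x\<close> is an equilibrium iff its columns add up to the
  demand and \<open>M x\<^sup>t - w\<^sup>t\<close> is independent of \<open>t\<close> (\<open>coalition_nash_iff\<close>). The matrix \<open>M\<close> is
  positive definite, hence invertible, and then this linear system has exactly one solution: applying
  the inverse of \<open>M\<close> shows that \<open>x\<^sup>t - M\<^sup>-\<^sup>1 w\<^sup>t\<close> is independent of \<open>t\<close>, and the demand
  determines the constant (\<open>balanced_solution_iff\<close>). Existence, uniqueness and the formula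
  follow together.
\<close>

section \<open>Optimality of a group of stations\<close>

text \<open>
  The derivative of the total cost of the group \<open>G\<close> with respect to the charge of its member \<open>i\<close> at
  time \<open>t\<close>. The sum over \<open>G\<close> comes from the effect of this charge on the price that every
  member pays.
\<close>

definition marginal_cost ::
  "real^'t \<Rightarrow> real \<Rightarrow> real^'n \<Rightarrow> real^'t^'n \<Rightarrow> 'n set \<Rightarrow> real^'t^'n \<Rightarrow> 'n \<Rightarrow> 't \<Rightarrow> real" where
  "marginal_cost a b \<mu> xbar G x i t =
     a $ t + b * ((\<Sum>j\<in>UNIV. x $ j $ t) + (\<Sum>j\<in>G. x $ j $ t)) + \<mu> $ i * (x $ i $ t - xbar $ i $ t)"

definition group_optimal ::
  "real^'t \<Rightarrow> real \<Rightarrow> real^'n \<Rightarrow> real^'t^'n \<Rightarrow> 'n set \<Rightarrow> real^'t^'n \<Rightarrow> bool" where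
  "group_optimal a b \<mu> xbar G x \<longleftrightarrow>
     (\<forall>x'. (\<forall>j\<in>G. x' $ j \<in> feasible xbar j) \<longrightarrow>
        (\<Sum>i\<in>G. cost a b \<mu> xbar x i) \<le> (\<Sum>i\<in>G. cost a b \<mu> xbar (coalition_deviation G x' x) i))"

lemma price_eq_sum: "price a b x t = a $ t + b * (\<Sum>j\<in>UNIV. x $ j $ t)"
  by (simp add: price_def inner_vec_def column_def)

lemma norm_add_diff_power2:
  fixes u v w :: "real^'t"
  shows "(norm (u + v - w))\<^sup>2 =
    (norm (u - w))\<^sup>2 + 2 * (\<Sum>t\<in>UNIV. (u $ t - w $ t) * v $ t) + (norm v)\<^sup>2"
proof -
  have "(norm (u + v - w))\<^sup>2 = (norm ((u - w) + v))\<^sup>2"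
    by (simp add: algebra_simps)
  also have "\<dots> = (norm (u - w))\<^sup>2 + 2 * ((u - w) \<bullet> v) + (norm v)\<^sup>2"
    by (simp add: power2_norm_eq_inner inner_add_left inner_add_right inner_commute)
  also have "(u - w) \<bullet> v = (\<Sum>t\<in>UNIV. (u $ t - w $ t) * v $ t)"
    by (simp add: inner_vec_def)
  finally show ?thesis .
qed

text \<open>
  The Taylor expansion of the total cost of \<open>G\<close> in a direction \<open>e\<close> in which only members of \<open>G\<close>
  move. It is exact because costs are quadratic.
\<close>

lemma sum_cost_add:
  fixes x e :: "real^'t^'n"
  assumes "\<And>j. j \<notin> G \<Longrightarrow> e $ j = 0"
  shows "(\<Sum>i\<in>G. cost a b \<mu> xbar (x + e) i) =
    (\<Sum>i\<in>G. cost a b \<mu> xbar x i) +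
    (\<Sum>i\<in>G. \<Sum>t\<in>UNIV. marginal_cost a b \<mu> xbar G x i t * e $ i $ t) +
    (b * (\<Sum>t\<in>UNIV. (\<Sum>i\<in>G. e $ i $ t)\<^sup>2) + (\<Sum>i\<in>G. \<mu> $ i / 2 * (norm (e $ i))\<^sup>2))"
proof -
  define E where "E t = (\<Sum>i\<in>G. e $ i $ t)" for t
  define Y where "Y t = (\<Sum>i\<in>G. x $ i $ t)" for t
  have E_UNIV: "(\<Sum>j\<in>UNIV. e $ j $ t) = E t" for t
    unfolding E_def by (rule sum.mono_neutral_right) (auto simp: assms)
  have price_add: "price a b (x + e) t = price a b x t + b * E t" for t
    by (simp add: price_eq_sum sum.distrib E_UNIV algebra_simps)
  have "(\<Sum>i\<in>G. \<Sum>t\<in>UNIV. price a b (x + e) t * (x + e) $ i $ t) =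
      (\<Sum>t\<in>UNIV. (price a b x t + b * E t) * (Y t + E t))"
    by (subst sum.swap) (simp add: price_add sum_distrib_left sum.distrib E_def Y_def distrib_left)
  also have "\<dots> = (\<Sum>t\<in>UNIV. price a b x t * Y t) +
      (\<Sum>t\<in>UNIV. (price a b x t + b * Y t) * E t) + b * (\<Sum>t\<in>UNIV. (E t)\<^sup>2)"
    by (simp add: sum.distrib[symmetric] sum_distrib_left algebra_simps power2_eq_square)
  also have "(\<Sum>t\<in>UNIV. price a b x t * Y t) = (\<Sum>i\<in>G. \<Sum>t\<in>UNIV. price a b x t * x $ i $ t)"
    by (subst sum.swap) (simp add: Y_def sum_distrib_left)
  also have "(\<Sum>t\<in>UNIV. (price a b x t + b * Y t) * E t) =
      (\<Sum>i\<in>G. \<Sum>t\<in>UNIV. (price a b x t + b * Y t) * e $ i $ t)"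
    by (subst sum.swap) (simp add: E_def sum_distrib_left)
  finally have payment: "(\<Sum>i\<in>G. \<Sum>t\<in>UNIV. price a b (x + e) t * (x + e) $ i $ t) =
      (\<Sum>i\<in>G. \<Sum>t\<in>UNIV. price a b x t * x $ i $ t) +
      (\<Sum>i\<in>G. \<Sum>t\<in>UNIV. (price a b x t + b * Y t) * e $ i $ t) + b * (\<Sum>t\<in>UNIV. (E t)\<^sup>2)" .
  have discomfort: "\<mu> $ i / 2 * (norm ((x + e) $ i - xbar $ i))\<^sup>2 =
      \<mu> $ i / 2 * (norm (x $ i - xbar $ i))\<^sup>2 +
      (\<Sum>t\<in>UNIV. \<mu> $ i * (x $ i $ t - xbar $ i $ t) * e $ i $ t) +
      \<mu> $ i / 2 * (norm (e $ i))\<^sup>2" for i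
    unfolding vector_add_component norm_add_diff_power2 distrib_left
    by (simp add: sum_distrib_left mult.assoc)
  have marginal: "marginal_cost a b \<mu> xbar G x i t * e $ i $ t =
      (price a b x t + b * Y t) * e $ i $ t + \<mu> $ i * (x $ i $ t - xbar $ i $ t) * e $ i $ t" for i t
    by (simp add: marginal_cost_def price_eq_sum Y_def algebra_simps)
  show ?thesis
    unfolding cost_def sum.distrib payment discomfort marginal E_def[symmetric]
    by (simp add: algebra_simps)
qed

lemma linear_part_eq_0:
  fixes L Q :: real
  assumes "\<And>r. 0 \<le> r * L + r\<^sup>2 * Q"
  shows "L = 0"
proof (rule ccontr)
  assume "L \<noteq> 0"
  \<comment> \<open>a step against the sign of \<open>L\<close>, so short that the linear term dominates\<close>
  define k where "k = \<bar>Q\<bar> + 1"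
  define r where "r = - L / k"
  have k: "k > 0" "Q - k < 0"
    by (auto simp: k_def)
  have "r * L + r\<^sup>2 * Q = (L / k)\<^sup>2 * (Q - k)"
    using k(1) by (simp add: r_def field_simps power2_eq_square)
  also have "\<dots> < 0"
    using \<open>L \<noteq> 0\<close> k by (intro mult_pos_neg) auto
  finally show False
    using assms[of r] by simp
qed

text \<open>
  For the forward direction, a member shifts charge from one time to another; as this is
  feasible in both directions, the two marginal costs agree. Conversely, time-independent marginal
  costs make the first-order part of \<open>sum_cost_add\<close> vanish, and the second-order part is nonnegative.
\<close>

lemma group_optimal_iff:
  fixes x :: "real^'t^'n"
  assumes "b > 0" and "\<forall>i. \<mu> $ i > 0" and x: "x \<in> joint_feasible xbar"
  shows "group_optimal a b \<mu> xbar G x \<longleftrightarrow>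
    (\<forall>i\<in>G. \<forall>s t. marginal_cost a b \<mu> xbar G x i s = marginal_cost a b \<mu> xbar G x i t)"
proof
  assume opt: "group_optimal a b \<mu> xbar G x"
  show "\<forall>i\<in>G. \<forall>s t. marginal_cost a b \<mu> xbar G x i s = marginal_cost a b \<mu> xbar G x i t"
  proof (intro ballI allI)
    fix i s t
    assume i: "i \<in> G"
    define h :: "real^'t" where "h = axis s 1 - axis t 1"
    define e :: "real^'t^'n" where "e = axis i h"
    have h_u: "h $ u = (if u = s then 1 else 0) - (if u = t then 1 else 0)" for u
      by (simp add: h_def axis_def)
    have h_sum: "(\<Sum>u\<in>UNIV. h $ u) = 0"
      by (simp add: h_u sum_subtractf)
    have e_i: "e $ j = (if j = i then h else 0)" for j
      by (auto simp: e_def axis_def)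
    define L where "L = (\<Sum>j\<in>G. \<Sum>u\<in>UNIV. marginal_cost a b \<mu> xbar G x j u * e $ j $ u)"
    define Q where
      "Q = b * (\<Sum>u\<in>UNIV. (\<Sum>j\<in>G. e $ j $ u)\<^sup>2) + (\<Sum>j\<in>G. \<mu> $ j / 2 * (norm (e $ j))\<^sup>2)"
    have "0 \<le> r * L + r\<^sup>2 * Q" for r
    proof -
      have dev: "coalition_deviation G (x + r *\<^sub>R e) x = x + r *\<^sub>R e"
        using i by (auto simp: coalition_deviation_def vec_eq_iff e_i)
      have "(x + r *\<^sub>R e) $ j \<in> feasible xbar j" for j
        using x h_sum
        by (auto simp: joint_feasible_def feasible_def e_i sum.distrib sum_distrib_left[symmetric])
      with opt have "(\<Sum>j\<in>G. cost a b \<mu> xbar x j) \<le> (\<Sum>j\<in>G. cost a b \<mu> xbar (x + r *\<^sub>R e) j)"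
        unfolding group_optimal_def by (metis dev)
      also have "\<dots> = (\<Sum>j\<in>G. cost a b \<mu> xbar x j) +
          (\<Sum>j\<in>G. \<Sum>u\<in>UNIV. marginal_cost a b \<mu> xbar G x j u * (r *\<^sub>R e) $ j $ u) +
          (b * (\<Sum>u\<in>UNIV. (\<Sum>j\<in>G. (r *\<^sub>R e) $ j $ u)\<^sup>2) +
           (\<Sum>j\<in>G. \<mu> $ j / 2 * (norm ((r *\<^sub>R e) $ j))\<^sup>2))"
        by (rule sum_cost_add) (use i in \<open>auto simp: e_i\<close>)
      also have "(\<Sum>j\<in>G. \<Sum>u\<in>UNIV. marginal_cost a b \<mu> xbar G x j u * (r *\<^sub>R e) $ j $ u) = r * L"
        by (simp add: L_def sum_distrib_left algebra_simps)
      also have "b * (\<Sum>u\<in>UNIV. (\<Sum>j\<in>G. (r *\<^sub>R e) $ j $ u)\<^sup>2) +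
           (\<Sum>j\<in>G. \<mu> $ j / 2 * (norm ((r *\<^sub>R e) $ j))\<^sup>2) = r\<^sup>2 * Q"
        by (simp add: Q_def sum_distrib_left[symmetric] power_mult_distrib distrib_left)
           (simp add: sum_distrib_left algebra_simps)
      finally show ?thesis by simp
    qed
    then have "L = 0"
      by (rule linear_part_eq_0)
    moreover have "L = (\<Sum>u\<in>UNIV. marginal_cost a b \<mu> xbar G x i u * h $ u)"
      unfolding L_def using i by (subst sum.remove[of G i]) (auto simp: e_i)
    moreover have "\<dots> = marginal_cost a b \<mu> xbar G x i s - marginal_cost a b \<mu> xbar G x i t"
      unfolding h_u right_diff_distrib sum_subtractf by (simp add: if_distrib cong: if_cong)
    ultimately show "marginal_cost a b \<mu> xbar G x i s = marginal_cost a b \<mu> xbar G x i t"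
      by simp
  qed
next
  assume const: "\<forall>i\<in>G. \<forall>s t. marginal_cost a b \<mu> xbar G x i s = marginal_cost a b \<mu> xbar G x i t"
  show "group_optimal a b \<mu> xbar G x"
    unfolding group_optimal_def
  proof (intro allI impI)
    fix x' :: "real^'t^'n"
    assume x': "\<forall>j\<in>G. x' $ j \<in> feasible xbar j"
    define e where "e = coalition_deviation G x' x - x"
    have e_i: "e $ j = (if j \<in> G then x' $ j - x $ j else 0)" for j
      by (simp add: e_def coalition_deviation_def)
    have first_order: "(\<Sum>t\<in>UNIV. marginal_cost a b \<mu> xbar G x i t * e $ i $ t) = 0" if "i \<in> G" for i
    proof -
      \<comment> \<open>\<open>undefined\<close> is an arbitrary reference time\<close>
      have "(\<Sum>t\<in>UNIV. marginal_cost a b \<mu> xbar G x i t * e $ i $ t) =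
          (\<Sum>t\<in>UNIV. marginal_cost a b \<mu> xbar G x i undefined * e $ i $ t)"
        using const that by (metis (no_types, lifting))
      also have "\<dots> = marginal_cost a b \<mu> xbar G x i undefined * (\<Sum>t\<in>UNIV. e $ i $ t)"
        by (simp add: sum_distrib_left)
      also have "(\<Sum>t\<in>UNIV. e $ i $ t) = 0"
        using x x' that by (auto simp: e_i joint_feasible_def feasible_def sum_subtractf)
      finally show ?thesis by simp
    qed
    have "(\<Sum>i\<in>G. cost a b \<mu> xbar (coalition_deviation G x' x) i) = (\<Sum>i\<in>G. cost a b \<mu> xbar (x + e) i)"
      by (simp add: e_def)
    also have "\<dots> = (\<Sum>i\<in>G. cost a b \<mu> xbar x i) +
        (\<Sum>i\<in>G. \<Sum>t\<in>UNIV. marginal_cost a b \<mu> xbar G x i t * e $ i $ t) +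
        (b * (\<Sum>t\<in>UNIV. (\<Sum>i\<in>G. e $ i $ t)\<^sup>2) + (\<Sum>i\<in>G. \<mu> $ i / 2 * (norm (e $ i))\<^sup>2))"
      by (rule sum_cost_add) (simp add: e_i)
    also have "(\<Sum>i\<in>G. \<Sum>t\<in>UNIV. marginal_cost a b \<mu> xbar G x i t * e $ i $ t) = 0"
      by (simp add: first_order)
    also have "0 \<le> b * (\<Sum>t\<in>UNIV. (\<Sum>i\<in>G. e $ i $ t)\<^sup>2) + (\<Sum>i\<in>G. \<mu> $ i / 2 * (norm (e $ i))\<^sup>2)"
      using assms(1,2) by (intro add_nonneg_nonneg mult_nonneg_nonneg sum_nonneg) (auto simp: less_imp_le)
    ultimately show "(\<Sum>i\<in>G. cost a b \<mu> xbar x i) \<le>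
        (\<Sum>i\<in>G. cost a b \<mu> xbar (coalition_deviation G x' x) i)"
      by simp
  qed
qed

lemma coalition_nash_iff_group_optimal:
  "coalition_nash a b \<mu> xbar C x \<longleftrightarrow>
    x \<in> joint_feasible xbar \<and> group_optimal a b \<mu> xbar C x \<and>
    (\<forall>i. i \<notin> C \<longrightarrow> group_optimal a b \<mu> xbar {i} x)"
proof -
  have deviation: "coalition_deviation {i} x' x = single_deviation i (x' $ i) x" for i x'
    by (auto simp: coalition_deviation_def single_deviation_def vec_eq_iff)
  have "group_optimal a b \<mu> xbar {i} x \<longleftrightarrow>
      (\<forall>y\<in>feasible xbar i. cost a b \<mu> xbar x i \<le> cost a b \<mu> xbar (single_deviation i y x) i)" for i
  proof
    assume opt: "group_optimal a b \<mu> xbar {i} x"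
    show "\<forall>y\<in>feasible xbar i. cost a b \<mu> xbar x i \<le> cost a b \<mu> xbar (single_deviation i y x) i"
    proof
      fix y assume "y \<in> feasible xbar i"
      then show "cost a b \<mu> xbar x i \<le> cost a b \<mu> xbar (single_deviation i y x) i"
        using opt[unfolded group_optimal_def, rule_format, of "\<chi> j. y"] by (simp add: deviation)
    qed
  qed (simp add: group_optimal_def deviation)
  then show ?thesis
    unfolding coalition_nash_def group_optimal_def[of a b \<mu> xbar C x] by simp
qed

section \<open>The game matrix and the equilibrium equations\<close>

text \<open>The group whose joint cost governs the charging of station \<open>i\<close> in an equilibrium.\<close>

definition group_of :: "'n set \<Rightarrow> 'n \<Rightarrow> 'n set" where
  "group_of C i = (if i \<in> C then C else {i})"

lemma diag_matrix_mult_component: "(diag_matrix \<mu> *v v) $ i = \<mu> $ i * v $ i"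
  by (simp add: diag_matrix_def matrix_vector_mult_def if_distrib if_distribR cong: if_cong)

lemma coalition_matrix_mult_component:
  "(coalition_matrix C *v v) $ i = (\<Sum>j\<in>group_of C i. v $ j)"
  by (auto simp: coalition_matrix_def matrix_vector_mult_def group_of_def
      if_distrib if_distribR sum.If_cases cong: if_cong)

lemma game_matrix_mult_component:
  "(game_matrix b \<mu> C *v v) $ i =
    b * ((\<Sum>j\<in>UNIV. v $ j) + (\<Sum>j\<in>group_of C i. v $ j)) + \<mu> $ i * v $ i"
proof -
  have "(outer 1 1 *v v) $ i = (\<Sum>j\<in>UNIV. v $ j)"
    by (simp add: outer_def matrix_vector_mult_def)
  then show ?thesis
    unfolding game_matrix_def
    by (simp add: matrix_vector_mult_add_rdistrib scaleR_matrix_vector_assoc[symmetric]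
        diag_matrix_mult_component coalition_matrix_mult_component)
qed

text \<open>
  The rank-one matrix of ones and the coalition matrix are positive semidefinite, and the diagonal
  part is positive definite.
\<close>

lemma invertible_game_matrix:
  assumes "b > 0" and \<mu>: "\<forall>i. \<mu> $ i > 0"
  shows "invertible (game_matrix b \<mu> C)"
proof -
  have "v = 0" if ker: "game_matrix b \<mu> C *v v = 0" for v
  proof -
    have split: "(\<Sum>i\<in>UNIV. v $ i * (\<Sum>j\<in>group_of C i. v $ j)) =
        (\<Sum>i\<in>C. v $ i)\<^sup>2 + (\<Sum>i\<in>-C. (v $ i)\<^sup>2)"
    proof -
      have "(\<Sum>i\<in>UNIV. v $ i * (\<Sum>j\<in>group_of C i. v $ j)) =
          (\<Sum>i\<in>C. v $ i * (\<Sum>j\<in>group_of C i. v $ j)) + (\<Sum>i\<in>-C. v $ i * (\<Sum>j\<in>group_of C i. v $ j))"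
        by (subst sum.union_disjoint[symmetric]) (auto simp: Compl_partition)
      then show ?thesis
        by (simp add: group_of_def power2_eq_square sum_distrib_right)
    qed
    have "0 = (\<Sum>i\<in>UNIV. v $ i * (game_matrix b \<mu> C *v v) $ i)"
      by (simp add: ker)
    also have "\<dots> = b * ((\<Sum>i\<in>UNIV. v $ i)\<^sup>2 + (\<Sum>i\<in>UNIV. v $ i * (\<Sum>j\<in>group_of C i. v $ j))) +
        (\<Sum>i\<in>UNIV. \<mu> $ i * (v $ i)\<^sup>2)"
      by (simp add: game_matrix_mult_component power2_eq_square sum.distrib[symmetric]
          sum_distrib_left sum_distrib_right algebra_simps)
    finally have "b * ((\<Sum>i\<in>UNIV. v $ i)\<^sup>2 + ((\<Sum>i\<in>C. v $ i)\<^sup>2 + (\<Sum>i\<in>-C. (v $ i)\<^sup>2))) +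
        (\<Sum>i\<in>UNIV. \<mu> $ i * (v $ i)\<^sup>2) = 0"
      by (simp add: split)
    moreover have "b * ((\<Sum>i\<in>UNIV. v $ i)\<^sup>2 + ((\<Sum>i\<in>C. v $ i)\<^sup>2 + (\<Sum>i\<in>-C. (v $ i)\<^sup>2))) \<ge> 0"
      using \<open>b > 0\<close> by (intro mult_nonneg_nonneg add_nonneg_nonneg sum_nonneg) auto
    moreover have nonneg: "\<mu> $ i * (v $ i)\<^sup>2 \<ge> 0" for i
      using \<mu> by (simp add: less_imp_le)
    ultimately have "(\<Sum>i\<in>UNIV. \<mu> $ i * (v $ i)\<^sup>2) = 0"
      by (simp add: add_nonneg_eq_0_iff sum_nonneg)
    then have "\<mu> $ i * (v $ i)\<^sup>2 = 0" for i
      using nonneg by (simp add: sum_nonneg_eq_0_iff)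
    then show "v = 0"
      using \<mu> by (simp add: vec_eq_iff) (metis less_irrefl)
  qed
  then show ?thesis
    by (simp add: invertible_left_inverse matrix_left_invertible_ker)
qed

lemma marginal_cost_eq_game_matrix:
  "marginal_cost a b \<mu> xbar (group_of C i) x i t =
    (game_matrix b \<mu> C *v column t x - (diag_matrix \<mu> *v column t xbar - (a $ t) *\<^sub>R 1)) $ i"
  by (simp add: marginal_cost_def game_matrix_mult_component diag_matrix_mult_component column_def
      algebra_simps)

lemma joint_feasible_iff_sum_columns:
  "x \<in> joint_feasible xbar \<longleftrightarrow> (\<Sum>t\<in>UNIV. column t x) = demand xbar"
  by (simp add: joint_feasible_def feasible_def vec_eq_iff column_def)

lemma coalition_nash_iff:
  fixes a :: "real^'t" and xbar x :: "real^'t^'n"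
  assumes "b > 0" and "\<forall>i. \<mu> $ i > 0"
  defines "w \<equiv> \<lambda>t. diag_matrix \<mu> *v column t xbar - (a $ t) *\<^sub>R 1"
  shows "coalition_nash a b \<mu> xbar C x \<longleftrightarrow>
    (\<Sum>t\<in>UNIV. column t x) = demand xbar \<and>
    (\<forall>s t. game_matrix b \<mu> C *v column s x - w s = game_matrix b \<mu> C *v column t x - w t)"
proof -
  have "group_optimal a b \<mu> xbar C x \<and> (\<forall>i. i \<notin> C \<longrightarrow> group_optimal a b \<mu> xbar {i} x) \<longleftrightarrow>
      (\<forall>i s t. marginal_cost a b \<mu> xbar (group_of C i) x i s =
        marginal_cost a b \<mu> xbar (group_of C i) x i t)"
    if "x \<in> joint_feasible xbar"
    using group_optimal_iff[OF assms(1,2) that] by (auto simp: group_of_def)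
  then show ?thesis
    unfolding coalition_nash_iff_group_optimal marginal_cost_eq_game_matrix
      joint_feasible_iff_sum_columns[symmetric] w_def
    by (subst vec_eq_iff) blast
qed

section \<open>Solving the equilibrium equations\<close>

text \<open>The weights in the closed form are those that subtract the mean over time.\<close>

lemma sum_kronecker_weights:
  fixes u :: "'t::finite \<Rightarrow> real^'n"
  shows "(\<Sum>t'\<in>UNIV. ((real CARD('t) * kronecker t t' - 1) / real CARD('t)) *\<^sub>R u t') =
    u t - (1 / real CARD('t)) *\<^sub>R (\<Sum>t'\<in>UNIV. u t')"
proof -
  have "((real CARD('t) * kronecker t t' - 1) / real CARD('t)) *\<^sub>R u t' =
      (if t = t' then u t' else 0) - (1 / real CARD('t)) *\<^sub>R u t'" for t'
    by (simp add: kronecker_def diff_divide_distrib scaleR_left_diff_distrib)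
  then show ?thesis
    by (simp add: sum_subtractf scaleR_sum_right)
qed

text \<open>
  For invertible \<open>A\<close>, the residual \<open>A *v y t - w t\<close> is independent of \<open>t\<close> iff \<open>y t\<close> minus the
  solution \<open>u t\<close> of \<open>A *v u t = w t\<close> is. The constant must then be the mean of this difference,
  which the prescribed sum of the \<open>y t\<close> determines.
\<close>

lemma balanced_solution_iff:
  fixes A :: "real^'n^'n" and y w :: "'t::finite \<Rightarrow> real^'n" and d :: "real^'n"
  assumes A: "invertible A"
  shows "(\<Sum>t\<in>UNIV. y t) = d \<and> (\<forall>s t. A *v y s - w s = A *v y t - w t) \<longleftrightarrow>
    (\<forall>t. y t = (1 / real CARD('t)) *\<^sub>R d +
      (\<Sum>t'\<in>UNIV. ((real CARD('t) * kronecker t t' - 1) / real CARD('t)) *\<^sub>R (matrix_inv A *v w t')))"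
proof -
  define u where "u t = matrix_inv A *v w t" for t
  define T where "T = real CARD('t)"
  have T: "T > 0"
    by (simp add: T_def)
  have inv: "matrix_inv A ** A = mat 1" "A ** matrix_inv A = mat 1"
    using someI_ex[OF A[unfolded invertible_def]] unfolding matrix_inv_def by blast+
  have w: "w t = A *v u t" for t
    by (simp add: u_def matrix_vector_mul_assoc inv)
  have cancel: "A *v v = A *v v' \<longleftrightarrow> v = v'" for v v'
    by (metis inv(1) matrix_vector_mul_assoc matrix_vector_mul_lid)
  have "A *v y s - w s = A *v y t - w t \<longleftrightarrow> y s - u s = y t - u t" for s t
    by (simp add: w matrix_vector_mult_diff_distrib[symmetric] cancel)
  moreover have "(\<Sum>t\<in>UNIV. y t) = d \<and> (\<forall>s t. y s - u s = y t - u t) \<longleftrightarrow>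
      (\<forall>t. y t = (1 / T) *\<^sub>R d + (u t - (1 / T) *\<^sub>R (\<Sum>t'\<in>UNIV. u t')))" (is "?L \<longleftrightarrow> ?R")
  proof
    assume L: ?L
    show ?R
    proof
      fix t
      have "d - (\<Sum>t'\<in>UNIV. u t') = (\<Sum>s\<in>UNIV. y s - u s)"
        using L by (simp add: sum_subtractf)
      also have "\<dots> = (\<Sum>s\<in>(UNIV::'t set). y t - u t)"
        using L by (metis (no_types, lifting))
      also have "\<dots> = T *\<^sub>R (y t - u t)"
        unfolding sum_constant_scaleR T_def ..
      finally have "y t - u t = (1 / T) *\<^sub>R (d - (\<Sum>t'\<in>UNIV. u t'))"
        using T by simp
      then show "y t = (1 / T) *\<^sub>R d + (u t - (1 / T) *\<^sub>R (\<Sum>t'\<in>UNIV. u t'))"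
        by (simp add: algebra_simps)
    qed
  next
    assume R: ?R
    have "(\<Sum>t\<in>UNIV. y t) =
        (\<Sum>t\<in>(UNIV::'t set). (1 / T) *\<^sub>R d + (u t - (1 / T) *\<^sub>R (\<Sum>t'\<in>UNIV. u t')))"
      using R by simp
    also have "\<dots> = T *\<^sub>R ((1 / T) *\<^sub>R d) + ((\<Sum>t\<in>UNIV. u t) - T *\<^sub>R ((1 / T) *\<^sub>R (\<Sum>t'\<in>UNIV. u t')))"
      unfolding sum.distrib sum_subtractf sum_constant_scaleR T_def by simp
    also have "\<dots> = d"
      using T by simp
    finally show ?L
      using R by simp
  qed
  ultimately show ?thesis
    unfolding u_def[symmetric] sum_kronecker_weights T_def by simp
qed

theorem theorem1:
  fixes a :: "real^'t" and b :: real and \<mu> :: "real^'n" and xbar :: "real^'t^'n"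
    and C :: "'n set"
  assumes "\<forall>t. a $ t > 0" and "b > 0" and "\<forall>i. \<mu> $ i > 0"
  shows "(\<exists>!x. coalition_nash a b \<mu> xbar C x) \<and>
    invertible (game_matrix b \<mu> C) \<and>
    (\<forall>x. coalition_nash a b \<mu> xbar C x \<longrightarrow>
      (\<forall>t. column t x =
        (1 / real CARD('t)) *\<^sub>R demand xbar +
        (\<Sum>t'\<in>UNIV. ((real CARD('t) * kronecker t t' - 1) / real CARD('t)) *\<^sub>R
           (matrix_inv (game_matrix b \<mu> C) *v
              (diag_matrix \<mu> *v column t' xbar - (a $ t') *\<^sub>R 1)))))"
proof -
  let ?M = "game_matrix b \<mu> C"
  define z where "z t = (1 / real CARD('t)) *\<^sub>R demand xbar +
    (\<Sum>t'\<in>UNIV. ((real CARD('t) * kronecker t t' - 1) / real CARD('t)) *\<^sub>R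
       (matrix_inv ?M *v (diag_matrix \<mu> *v column t' xbar - (a $ t') *\<^sub>R 1)))" for t
  have inv: "invertible ?M"
    using assms(2,3) by (rule invertible_game_matrix)
  have nash_iff: "coalition_nash a b \<mu> xbar C x \<longleftrightarrow> (\<forall>t. column t x = z t)" for x
    unfolding coalition_nash_iff[OF assms(2,3)] balanced_solution_iff[OF inv] z_def ..
  have "\<exists>!x :: real^'t^'n. \<forall>t. column t x = z t"
  proof
    show "\<forall>t. column t (\<chi> i t. z t $ i) = z t"
      by (simp add: column_def)
  next
    fix x :: "real^'t^'n"
    assume "\<forall>t. column t x = z t"
    then show "x = (\<chi> i t. z t $ i)"
      by (auto simp: column_def vec_eq_iff)
  qed
  with inv show ?thesis
    unfolding nash_iff z_def by blast
qed

end
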